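(* Let $d\ge 3$ and let $\mathcal K\subset\mathbb C^d$ be a Kochen–Specker (KS) set in dimension $d$. Then there exist an integer $k$ with $2\le k\le d$ and a subset $\mathcal S\subseteq\mathcal K$ such that $\mathcal S$ is a gadget of order $(k,k-1)$ in dimension $d$.
   Context: All vector sets are finite sets of pairwise non-parallel unit vectors in $\mathbb C^d$. The orthogonality graph of such a set has the vectors as vertices, two vertices being adjacent iff the vectors are orthogonal. For a finite simple graph $G$ with clique number $\omega(G)$, a $\{0,1\}$-coloring of $G$ is a map $f:V_G\to\{0,1\}$ such that (i) $\sum_{v\in C}f(v)\le 1$ for every clique $C$ of $G$, and (ii) every clique $C$ of size $\omega(G)$ contains exactly one vertex $v$ with $f(v)=1$. A $\{0,1\}$-coloring of a set of vectors is a $\{0,1\}$-coloring of its orthogonality graph. A KS set in dimension $d$ is a finite set of vectors in $\mathbb C^d$ admitting no assignment $f$ of values in $\{0,1\}$ such that two orthogonal vectors are never both assigned $1$ and, among any $d$ mutually orthogonal vectors of the set, one is assigned $1$. (Such a set necessarily contains $d$ mutually orthogonal vectors, so its orthogonality graph has clique number $d$, and this is the same as saying that it has no $\{0,1\}$-coloring.) A gadget of order $(m,k)$ in dimension $d$ is a set of vectors $\mathcal S\subset\mathbb C^d$ whose orthogonality graph has clique number $d$, which admits a $\{0,1\}$-coloring, and which contains a distinguished proper subset $\widetilde{\mathcal S}\subsetneq\mathcal S$ of $m$ mutually non-orthogonal vectors such that: for every $\mathcal R\subseteq\widetilde{\mathcal S}$ with $|\mathcal R|\le k$ there is a $\{0,1\}$-coloring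 of $\mathcal S$ assigning $1$ to all vectors of $\mathcal R$; and for every $\mathcal R\subseteq\widetilde{\mathcal S}$ with $|\mathcal R|>k$ no $\{0,1\}$-coloring of $\mathcal S$ assigns $1$ to all vectors of $\mathcal R$. *)

theory Defs
  imports "Jordan_Normal_Form.Conjugate" "Jordan_Normal_Form.Matrix" "Graph_Theory.Pair_Digraph"
begin

text \<open>A finite simple graph is a \<^term>\<open>G\<close> with \<^prop>\<open>pair_graph G\<close>:
  finitely many vertices and a symmetric, irreflexive adjacency relation \<^term>\<open>parcs G\<close>.\<close>

definition is_clique :: "'a pair_pre_digraph \<Rightarrow> 'a set \<Rightarrow> bool" where
  "is_clique G C \<longleftrightarrow> C \<subseteq> pverts G \<and> pairwise (\<lambda>u v. (u, v) \<in> parcs G) C"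

text \<open>The maximum is meaningful for finite vertex sets; the empty set is always a clique.\<close>

definition clique_number :: "'a pair_pre_digraph \<Rightarrow> nat" where
  "clique_number G = Max {card C | C. is_clique G C}"

definition coloring01 :: "'a pair_pre_digraph \<Rightarrow> ('a \<Rightarrow> nat) \<Rightarrow> bool" where
  "coloring01 G f \<longleftrightarrow>
     (\<forall>v\<in>pverts G. f v \<in> {0, 1}) \<and>
     (\<forall>C. is_clique G C \<longrightarrow> (\<Sum>v\<in>C. f v) \<le> 1) \<and>
     (\<forall>C. is_clique G C \<and> card C = clique_number G \<longrightarrow> (\<exists>!v. v \<in> C \<and> f v = 1))"

text \<open>Here \<open>u \<bullet>c v\<close> is the Hermitian inner product, conjugate-linear in \<open>v\<close>.\<close>

definition orthogonal_vec :: "complex vec \<Rightarrow> complex vec \<Rightarrow> bool" where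
  "orthogonal_vec u v \<longleftrightarrow> u \<bullet>c v = 0"

definition parallel_vec :: "complex vec \<Rightarrow> complex vec \<Rightarrow> bool" where
  "parallel_vec u v \<longleftrightarrow> (\<exists>c. u = c \<cdot>\<^sub>v v) \<or> (\<exists>c. v = c \<cdot>\<^sub>v u)"

definition vector_set :: "nat \<Rightarrow> complex vec set \<Rightarrow> bool" where
  "vector_set d S \<longleftrightarrow>
     finite S \<and> S \<subseteq> carrier_vec d \<and> (\<forall>v\<in>S. v \<bullet>c v = 1) \<and>
     pairwise (\<lambda>u v. \<not> parallel_vec u v) S"

definition orthogonality_graph :: "complex vec set \<Rightarrow> complex vec pair_pre_digraph" where
  "orthogonality_graph S =
     \<lparr>pverts = S, parcs = {(u, v). u \<in> S \<and> v \<in> S \<and> orthogonal_vec u v}\<rparr>"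

lemma pair_graph_orthogonality_graph:
  assumes "vector_set d S"
  shows "pair_graph (orthogonality_graph S)"
proof -
  have fin: "finite S" and carr: "S \<subseteq> carrier_vec d" and unit: "\<And>v. v \<in> S \<Longrightarrow> v \<bullet>c v = 1"
    using assms by (auto simp: vector_set_def)
  have sym: "orthogonal_vec v u" if "u \<in> S" "v \<in> S" "orthogonal_vec u v" for u v
  proof -
    have carr': "u \<in> carrier_vec d" "conjugate v \<in> carrier_vec d"
      using that carr by auto
    have "v \<bullet>c u = conjugate (conjugate v \<bullet> u)"
      using carr' that carr by (subst conjugate_conjugate_sprod[of _ d]) auto
    also have "conjugate v \<bullet> u = u \<bullet>c v"
      by (rule comm_scalar_prod[OF carr'(2,1)])
    finally show ?thesis using that(3) by (simp add: orthogonal_vec_def)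
  qed
  have irrefl: "\<not> orthogonal_vec v v" if "v \<in> S" for v
    using unit[OF that] by (simp add: orthogonal_vec_def)
  have "finite (parcs (orthogonality_graph S))"
    by (rule finite_subset[of _ "S \<times> S"]) (auto simp: orthogonality_graph_def fin)
  moreover have "symmetric (with_proj (orthogonality_graph S))"
    using sym by (auto simp: orthogonality_graph_def Digraph.symmetric_def sym_def)
  ultimately show ?thesis
    using irrefl fin by unfold_locales (auto simp: orthogonality_graph_def)
qed

definition set_coloring01 :: "complex vec set \<Rightarrow> (complex vec \<Rightarrow> nat) \<Rightarrow> bool" where
  "set_coloring01 S f \<longleftrightarrow> coloring01 (orthogonality_graph S) f"

definition KS_set :: "nat \<Rightarrow> complex vec set \<Rightarrow> bool" where
  "KS_set d K \<longleftrightarrow>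
     vector_set d K \<and>
     \<not> (\<exists>f :: complex vec \<Rightarrow> nat.
          (\<forall>v\<in>K. f v \<in> {0, 1}) \<and>
          (\<forall>u\<in>K. \<forall>v\<in>K. orthogonal_vec u v \<longrightarrow> \<not> (f u = 1 \<and> f v = 1)) \<and>
          (\<forall>C. C \<subseteq> K \<and> card C = d \<and> pairwise orthogonal_vec C \<longrightarrow> (\<exists>v\<in>C. f v = 1)))"

definition gadget :: "nat \<Rightarrow> nat \<Rightarrow> nat \<Rightarrow> complex vec set \<Rightarrow> bool" where
  "gadget d m k S \<longleftrightarrow>
     vector_set d S \<and>
     clique_number (orthogonality_graph S) = d \<and>
     (\<exists>f. set_coloring01 S f) \<and>
     (\<exists>T. T \<subset> S \<and> card T = m \<and> pairwise (\<lambda>u v. \<not> orthogonal_vec u v) T \<and>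
        (\<forall>R. R \<subseteq> T \<and> card R \<le> k \<longrightarrow> (\<exists>f. set_coloring01 S f \<and> (\<forall>v\<in>R. f v = 1))) \<and>
        (\<forall>R. R \<subseteq> T \<and> card R > k \<longrightarrow> \<not> (\<exists>f. set_coloring01 S f \<and> (\<forall>v\<in>R. f v = 1))))"

end

theory Submission
  imports Defs "Jordan_Normal_Form.Determinant"
begin

text \<open>Let \<open>I\<close> be a maximal set of pairwise non-orthogonal vectors of \<open>K\<close>. Its indicator function is not
  a KS assignment, so \<open>K\<close> contains an orthonormal basis \<open>B\<close> disjoint from \<open>I\<close>, and by maximality every
  vector of \<open>B\<close> is orthogonal to some vector of \<open>I\<close>. Let \<open>T \<subseteq> I\<close> be minimal with this covering
  property; then \<open>card T \<le> d\<close>, and \<open>card T \<ge> 2\<close> because no unit vector is orthogonal to all of \<open>B\<close>.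
  In \<open>S = T \<union> B\<close> the only basis is \<open>B\<close>. Giving \<open>1\<close> to all of \<open>T\<close> would force \<open>0\<close> on all of \<open>B\<close>,
  whereas a proper subset of \<open>T\<close> leaves some \<open>b \<in> B\<close> uncovered, and \<open>b\<close> can then receive the value
  \<open>1\<close>.\<close>

section \<open>Orthonormal bases of the ambient space\<close>

lemma orthogonal_vec_sym:
  assumes "u \<in> carrier_vec d" "v \<in> carrier_vec d" "orthogonal_vec u v"
  shows "orthogonal_vec v u"
proof -
  have cv: "conjugate v \<in> carrier_vec d"
    using assms(2) by simp
  have "v \<bullet>c u = conjugate (conjugate v \<bullet> u)"
    using assms cv by (subst conjugate_conjugate_sprod[of _ d]) auto
  also have "conjugate v \<bullet> u = u \<bullet>c v"
    by (rule comm_scalar_prod[OF cv assms(1)])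
  finally show ?thesis using assms(3) by (simp add: orthogonal_vec_def)
qed

text \<open>Orthonormality of \<open>C\<close> amounts to \<open>A * A' = 1\<close>, where
  \<open>A\<close> has the conjugated vectors as rows and \<open>A'\<close> the vectors themselves
  as columns. Both matrices are square because \<open>card C = d\<close>, so
  \<open>A' * A = 1\<close> as well, and \<open>A x = 0\<close> yields
  \<open>x = A' (A x) = 0\<close>.\<close>

lemma orthogonal_to_basis_imp_zero:
  assumes carr: "C \<subseteq> carrier_vec d" and unit: "\<And>v. v \<in> C \<Longrightarrow> v \<bullet>c v = 1"
    and orth: "pairwise orthogonal_vec C" and card: "card C = d" and fin: "finite C"
    and x: "x \<in> carrier_vec d" and xorth: "\<And>v. v \<in> C \<Longrightarrow> orthogonal_vec x v"
  shows "x = 0\<^sub>v d"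
proof -
  obtain bs where bs: "set bs = C" "distinct bs"
    using finite_distinct_list[OF fin] by blast
  have len: "length bs = d"
    using bs card distinct_card by fastforce
  have nth: "bs ! i \<in> C" if "i < d" for i
    using bs(1) len that by auto
  have nthc: "bs ! i \<in> carrier_vec d" if "i < d" for i
    using nth that carr by auto
  define A where "A = mat_of_rows d (map conjugate bs)"
  define A' where "A' = mat_of_cols d bs"
  have A: "A \<in> carrier_mat d d" and A': "A' \<in> carrier_mat d d"
    by (auto simp: A_def A'_def len)
  have row: "row A i = conjugate (bs ! i)" if "i < d" for i
    unfolding A_def using that nthc[OF that] len by (subst mat_of_rows_row) auto
  have col: "col A' j = bs ! j" if "j < d" for j
    unfolding A'_def using that nthc[OF that] len by (subst col_mat_of_cols) auto
  have "A * A' = 1\<^sub>m d"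
  proof (rule eq_matI)
    fix i j assume "i < dim_row (1\<^sub>m d :: complex mat)" "j < dim_col (1\<^sub>m d :: complex mat)"
    then have ij: "i < d" "j < d" by auto
    have "(A * A') $$ (i, j) = conjugate (bs ! i) \<bullet> (bs ! j)"
      using ij A A' row col by simp
    also have "\<dots> = bs ! j \<bullet>c bs ! i"
      using ij nthc by (intro comm_scalar_prod) auto
    also have "\<dots> = 1\<^sub>m d $$ (i, j)"
    proof (cases "i = j")
      case True
      then show ?thesis using ij unit[OF nth] by simp
    next
      case False
      then have "bs ! j \<noteq> bs ! i"
        using bs(2) ij len nth_eq_iff_index_eq by blast
      then show ?thesis
        using ij False pairwiseD[OF orth nth nth] by (simp add: orthogonal_vec_def)
    qed
    finally show "(A * A') $$ (i, j) = 1\<^sub>m d $$ (i, j)" .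
  qed (use A A' in auto)
  then have inv: "A' * A = 1\<^sub>m d"
    by (rule mat_mult_left_right_inverse[OF A A'])
  have "A *\<^sub>v x = 0\<^sub>v d"
  proof (rule eq_vecI)
    fix i assume "i < dim_vec (0\<^sub>v d :: complex vec)"
    then have i: "i < d" by simp
    have "(A *\<^sub>v x) $ i = conjugate (bs ! i) \<bullet> x"
      using i A row by simp
    also have "\<dots> = x \<bullet>c bs ! i"
      using i nthc x by (intro comm_scalar_prod) auto
    also have "\<dots> = 0"
      using xorth[OF nth[OF i]] by (simp add: orthogonal_vec_def)
    finally show "(A *\<^sub>v x) $ i = 0\<^sub>v d $ i" using i by simp
  qed (use A in auto)
  then have "A' *\<^sub>v (A *\<^sub>v x) = 0\<^sub>v d"
    using A' by (auto intro!: eq_vecI)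
  then show ?thesis
    using inv x assoc_mult_mat_vec[OF A' A x] by simp
qed

section \<open>Cliques and bases in vector sets\<close>

lemma is_clique_orthogonality_graph:
  "is_clique (orthogonality_graph S) C \<longleftrightarrow> C \<subseteq> S \<and> pairwise orthogonal_vec C"
  unfolding is_clique_def orthogonality_graph_def pairwise_def by auto

lemma vector_set_subset: "vector_set d K \<Longrightarrow> S \<subseteq> K \<Longrightarrow> vector_set d S"
  unfolding vector_set_def by (meson finite_subset pairwise_subset subset_iff subset_trans)

lemma vector_set_unit_not_orthogonal:
  assumes "vector_set d S" "v \<in> S"
  shows "\<not> orthogonal_vec v v"
  using assms by (auto simp: vector_set_def orthogonal_vec_def)

text \<open>Otherwise \<open>t\<close> would be the zero vector, which is not a unit vector. This
  serves both to bound clique sizes and to exclude covers of a basis by a single vector.\<close>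

lemma not_orthogonal_to_basis:
  assumes S: "vector_set d S" and C: "C \<subseteq> S" "pairwise orthogonal_vec C" "card C = d" and t: "t \<in> S"
  shows "\<exists>v\<in>C. \<not> orthogonal_vec t v"
proof (rule ccontr)
  assume "\<not> ?thesis"
  moreover have "finite C" using S C(1) by (simp add: vector_set_def finite_subset)
  ultimately have "t = 0\<^sub>v d"
    using S C t by (intro orthogonal_to_basis_imp_zero[of C]) (auto simp: vector_set_def)
  then have "t \<bullet>c t = 0" by simp
  then show False
    using vector_set_unit_not_orthogonal[OF S t] by (simp add: orthogonal_vec_def)
qed

text \<open>A larger clique would contain \<open>d\<close> mutually orthogonal vectors and a further
  vector orthogonal to all of them.\<close>

lemma clique_card_le:
  assumes S: "vector_set d S" and C: "C \<subseteq> S" "pairwise orthogonal_vec C"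
  shows "card C \<le> d"
proof (rule ccontr)
  assume "\<not> card C \<le> d"
  then obtain D where D: "D \<subseteq> C" "card D = d"
    by (meson nat_le_linear obtain_subset_with_card_n)
  with \<open>\<not> card C \<le> d\<close> have "\<not> C \<subseteq> D" by auto
  then obtain t where t: "t \<in> C" "t \<notin> D" by blast
  obtain v where v: "v \<in> D" "\<not> orthogonal_vec t v"
    using not_orthogonal_to_basis[OF S _ pairwise_subset[OF C(2) D(1)] D(2)] C(1) D(1) t(1) by blast
  have "v \<in> C" "t \<noteq> v" using v(1) D(1) t(2) by auto
  then show False
    using pairwiseD[OF C(2) t(1)] v(2) by simp
qed

lemma clique_number_orthogonality_graph:
  assumes S: "vector_set d S" and C: "C \<subseteq> S" "pairwise orthogonal_vec C" "card C = d"
  shows "clique_number (orthogonality_graph S) = d"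
  unfolding clique_number_def is_clique_orthogonality_graph
proof (rule Max_eqI)
  have "finite S" using S by (simp add: vector_set_def)
  then show "finite {card C |C. C \<subseteq> S \<and> pairwise orthogonal_vec C}"
    by simp
qed (use C clique_card_le[OF S] in auto)

text \<open>The difference \<open>t - (t \<bullet>c b) b\<close> is orthogonal to the whole basis.\<close>

lemma orthogonal_to_all_but_one_imp_parallel:
  assumes S: "vector_set d S" and B: "B \<subseteq> S" "pairwise orthogonal_vec B" "card B = d"
    and t: "t \<in> S" and b: "b \<in> B" and orth: "\<And>v. v \<in> B - {b} \<Longrightarrow> orthogonal_vec t v"
  shows "parallel_vec t b"
proof -
  have carr: "v \<in> carrier_vec d" if "v \<in> S" for v
    using S that by (auto simp: vector_set_def)
  have tc: "t \<in> carrier_vec d" and bc: "b \<in> carrier_vec d"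
    using carr t b B by auto
  define x where "x = t - (t \<bullet>c b) \<cdot>\<^sub>v b"
  have ip: "x \<bullet>c v = t \<bullet>c v - (t \<bullet>c b) * (b \<bullet>c v)" if "v \<in> B" for v
  proof -
    have "conjugate v \<in> carrier_vec d" using that B carr by auto
    then show ?thesis
      unfolding x_def using tc bc
      by (simp add: minus_scalar_prod_distrib[of _ d])
  qed
  have bb: "b \<bullet>c b = 1" using S b B by (auto simp: vector_set_def)
  have "orthogonal_vec x v" if v: "v \<in> B" for v
  proof (cases "v = b")
    case True
    then show ?thesis using ip[OF v] bb by (simp add: orthogonal_vec_def)
  next
    case False
    then show ?thesis
      using ip[OF v] orth[of v] v b pairwiseD[OF B(2) b v] by (simp add: orthogonal_vec_def)
  qed
  moreover have "finite B" using S B(1) by (simp add: vector_set_def finite_subset)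
  ultimately have "x = 0\<^sub>v d"
    using S B tc bc
    by (intro orthogonal_to_basis_imp_zero[of B]) (auto simp: vector_set_def x_def)
  have "t = (t \<bullet>c b) \<cdot>\<^sub>v b"
  proof (rule eq_vecI)
    fix i assume i: "i < dim_vec ((t \<bullet>c b) \<cdot>\<^sub>v b)"
    then have "x $ i = 0" using \<open>x = 0\<^sub>v d\<close> bc by simp
    then show "t $ i = ((t \<bullet>c b) \<cdot>\<^sub>v b) $ i" using i by (simp add: x_def)
  qed (use tc bc in auto)
  then show ?thesis unfolding parallel_vec_def by blast
qed

section \<open>Colorings as indicator functions\<close>

lemma set_coloring01_clique:
  assumes "set_coloring01 S f" "C \<subseteq> S" "pairwise orthogonal_vec C"
  shows "(\<Sum>v\<in>C. f v) \<le> 1"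
  using assms by (auto simp: set_coloring01_def coloring01_def is_clique_orthogonality_graph)

text \<open>Two distinct elements of \<open>X\<close> in one clique would be both orthogonal and
  non-orthogonal, so each clique meets \<open>X\<close> at most once. By \<open>cl\<close> the
  cliques of maximum size are the bases, where \<open>bases\<close> supplies the one element
  required.\<close>

lemma set_coloring01_indicator:
  assumes S: "vector_set d S" and ind: "X \<subseteq> S" "pairwise (\<lambda>u v. \<not> orthogonal_vec u v) X"
    and bases: "\<And>C. C \<subseteq> S \<Longrightarrow> pairwise orthogonal_vec C \<Longrightarrow> card C = d \<Longrightarrow> C \<inter> X \<noteq> {}"
    and cl: "clique_number (orthogonality_graph S) = d"
  shows "set_coloring01 S (\<lambda>v. if v \<in> X then 1 else 0)"
proof -
  let ?f = "\<lambda>v. if v \<in> X then 1 else 0 :: nat"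
  have uniq: "u = v" if "pairwise orthogonal_vec C" "u \<in> C \<inter> X" "v \<in> C \<inter> X" for C u v
    using that ind(2) unfolding pairwise_def by auto
  have "(\<Sum>v\<in>C. ?f v) \<le> 1" if "C \<subseteq> S" "pairwise orthogonal_vec C" for C
  proof -
    have fin: "finite C" using S that(1) by (simp add: vector_set_def finite_subset)
    have "(\<Sum>v\<in>C. ?f v) = card (C \<inter> X)"
      using fin by (simp add: sum.If_cases)
    also have "\<dots> \<le> 1"
      using fin uniq[OF that(2)] by (auto simp: card_le_Suc0_iff_eq)
    finally show ?thesis .
  qed
  moreover have "\<exists>!v. v \<in> C \<and> ?f v = 1" if "C \<subseteq> S" "pairwise orthogonal_vec C" "card C = d" for C
    using bases[OF that] uniq[OF that(2)] by auto
  ultimately show ?thesis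
    unfolding set_coloring01_def coloring01_def is_clique_orthogonality_graph cl by auto
qed

section \<open>Gadgets from minimal covers of a basis\<close>

lemma gadget_of_minimal_cover:
  assumes S: "vector_set d (T \<union> B)"
    and B: "pairwise orthogonal_vec B" "card B = d"
    and T: "pairwise (\<lambda>u v. \<not> orthogonal_vec u v) T" "T \<inter> B = {}" "B \<noteq> {}"
    and cover: "\<And>b. b \<in> B \<Longrightarrow> \<exists>t\<in>T. orthogonal_vec t b"
    and minimal: "\<And>R. R \<subset> T \<Longrightarrow> \<exists>b\<in>B. \<forall>t\<in>R. \<not> orthogonal_vec t b"
  shows "gadget d (card T) (card T - 1) (T \<union> B)"
proof -
  let ?S = "T \<union> B"
  have carr: "v \<in> carrier_vec d" if "v \<in> ?S" for v
    using S that by (auto simp: vector_set_def)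
  have sym: "orthogonal_vec v u" if "orthogonal_vec u v" "u \<in> ?S" "v \<in> ?S" for u v
    using orthogonal_vec_sym carr that by blast
  have fin: "finite T" "finite B" using S by (auto simp: vector_set_def)
  have cl: "clique_number (orthogonality_graph ?S) = d"
    using clique_number_orthogonality_graph[OF S _ B] by auto
  have "T \<noteq> {}" using cover T(3) by blast
  \<comment> \<open>Positivity makes the truncated difference \<open>card T - 1\<close> strictly
    smaller than \<open>card T\<close>; both thresholds below rely on this.\<close>
  then have Tpos: "card T > 0" using fin by (simp add: card_gt_0_iff)
  \<comment> \<open>A basis \<open>C\<close> different from \<open>B\<close> contains some
    \<open>t\<close> in \<open>T\<close>, and only one, since \<open>T\<close> has no orthogonal
    pairs. It then shares \<open>d - 1\<close> vectors with \<open>B\<close>, so \<open>t\<close> is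
    parallel to the remaining vector of \<open>B\<close>, which a vector set forbids.\<close>
  have only_basis: "C = B" if C: "C \<subseteq> ?S" "pairwise orthogonal_vec C" "card C = d" for C
  proof (cases "C \<subseteq> B")
    case True
    then show ?thesis using C(3) B(2) fin by (simp add: card_subset_eq)
  next
    case False
    then obtain t where t: "t \<in> C" "t \<in> T" "t \<notin> B" using C(1) by auto
    have CB: "C - {t} \<subseteq> B"
      using C t T(1) unfolding pairwise_def by blast
    have "finite C" using C(1) fin by (simp add: finite_subset)
    then have "card (B - (C - {t})) = d - (d - 1)"
      using C(3) B(2) t(1) by (simp add: card_Diff_subset[OF _ CB])
    \<comment> \<open>For \<open>d = 0\<close> the truncated \<open>d - (d - 1)\<close> would be 0
      rather than 1.\<close>
    moreover have "d > 0" using B(2) T(3) fin by auto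
    ultimately have "card (B - (C - {t})) = 1" by simp
    then obtain b where b: "B - (C - {t}) = {b}"
      by (auto simp: card_1_singleton_iff)
    have "parallel_vec t b"
    proof (rule orthogonal_to_all_but_one_imp_parallel[OF S _ B])
      fix v assume "v \<in> B - {b}"
      then have "v \<in> C" "v \<noteq> t" using b by auto
      then show "orthogonal_vec t v" using C(2) t(1) by (auto simp: pairwise_def)
    qed (use b t in auto)
    moreover have "b \<in> B" "t \<noteq> b" using b t(3) by auto
    ultimately have False
      using S t(2) unfolding vector_set_def pairwise_def by blast
    then show ?thesis ..
  qed
  have colorable: "\<exists>f. set_coloring01 ?S f \<and> (\<forall>v\<in>R. f v = 1)" if R: "R \<subseteq> T" "card R \<le> card T - 1" for R
  proof -
    have "R \<subset> T" using R Tpos by auto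
    then obtain b where b: "b \<in> B" "\<forall>t\<in>R. \<not> orthogonal_vec t b" using minimal by blast
    \<comment> \<open>The color class is \<open>R\<close> together with the uncovered
      \<open>b\<close>, which makes it meet \<open>B\<close>, the only basis.\<close>
    have "pairwise (\<lambda>u v. \<not> orthogonal_vec u v) (insert b R)"
      using b R(1) sym pairwise_subset[OF T(1) R(1)] by (auto simp: pairwise_insert)
    then have "set_coloring01 ?S (\<lambda>v. if v \<in> insert b R then 1 else 0)"
      using b(1) R(1) only_basis by (intro set_coloring01_indicator[OF S _ _ _ cl]) auto
    then show ?thesis by (intro exI conjI) auto
  qed
  have not_colorable: "\<not> (\<exists>f. set_coloring01 ?S f \<and> (\<forall>v\<in>R. f v = 1))"
    if R: "R \<subseteq> T" "card R > card T - 1" for R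
  proof
    assume "\<exists>f. set_coloring01 ?S f \<and> (\<forall>v\<in>R. f v = 1)"
    \<comment> \<open>Above the threshold \<open>card T - 1\<close> the only subset of
      \<open>T\<close> is \<open>T\<close> itself.\<close>
    moreover have "R = T" using R fin Tpos by (intro card_seteq) auto
    ultimately obtain f where f: "set_coloring01 ?S f" "\<forall>v\<in>T. f v = 1" by blast
    then have "\<exists>!v. v \<in> B \<and> f v = 1"
      using B cl by (auto simp: set_coloring01_def coloring01_def is_clique_orthogonality_graph)
    then obtain b where b: "b \<in> B" "f b = 1" by blast
    obtain t where t: "t \<in> T" "orthogonal_vec t b" using cover[OF b(1)] by blast
    have "(\<Sum>v\<in>{t, b}. f v) \<le> 1"
      using f(1) t b(1) sym by (intro set_coloring01_clique) (auto simp: pairwise_insert)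
    moreover have "t \<noteq> b" using t b T(2) by auto
    ultimately show False using f(2) t b by simp
  qed
  have "\<exists>f. set_coloring01 ?S f" using colorable[of "{}"] by auto
  moreover have "T \<subset> ?S" using T(2,3) by auto
  ultimately show ?thesis
    unfolding gadget_def using S cl T(1) colorable not_colorable
    by (intro conjI exI[of _ T]) auto
qed

section \<open>Choosing the basis and the cover in a KS set\<close>

text \<open>The indicator function of \<open>I\<close> never gives 1 to two orthogonal vectors, so
  the KS property can only be violated by a basis on which it vanishes.\<close>

lemma KS_set_basis_avoiding:
  assumes K: "KS_set d K" and I: "I \<subseteq> K" "pairwise (\<lambda>u v. \<not> orthogonal_vec u v) I"
  obtains B where "B \<subseteq> K" "card B = d" "pairwise orthogonal_vec B" "B \<inter> I = {}"
proof -
  define f :: "complex vec \<Rightarrow> nat" where "f v = (if v \<in> I then 1 else 0)" for v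
  have "\<not> orthogonal_vec u v" if "f u = 1" "f v = 1" for u v
  proof -
    have uv: "u \<in> I" "v \<in> I" using that unfolding f_def by (metis zero_neq_one)+
    \<comment> \<open>The KS condition ranges over all pairs, whereas \<open>pairwise\<close> speaks
      only of distinct ones; unit length settles the diagonal.\<close>
    moreover have "\<not> orthogonal_vec u u"
      using vector_set_unit_not_orthogonal[of d K] K uv(1) I(1) by (auto simp: KS_set_def)
    ultimately show ?thesis using I(2) by (cases "u = v") (auto simp: pairwise_def)
  qed
  moreover have "\<forall>v\<in>K. f v \<in> {0, 1}" by (simp add: f_def)
  ultimately have "\<not> (\<forall>C. C \<subseteq> K \<and> card C = d \<and> pairwise orthogonal_vec C \<longrightarrow> (\<exists>v\<in>C. f v = 1))"
    using K unfolding KS_set_def by blast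
  then obtain B where B: "B \<subseteq> K" "card B = d" "pairwise orthogonal_vec B" "\<forall>v\<in>B. f v \<noteq> 1"
    by blast
  moreover have "B \<inter> I = {}" using B(4) by (auto simp: f_def)
  ultimately show thesis using that by blast
qed

text \<open>Take \<open>I\<close> maximal under inclusion: a vector of \<open>K - I\<close>
  orthogonal to no element of \<open>I\<close> could be added to it.\<close>

lemma maximal_non_orthogonal_subset:
  assumes K: "vector_set d K"
  obtains I where "I \<subseteq> K" "pairwise (\<lambda>u v. \<not> orthogonal_vec u v) I"
    "\<And>v. v \<in> K - I \<Longrightarrow> \<exists>u\<in>I. orthogonal_vec u v"
proof -
  define F where "F = {I. I \<subseteq> K \<and> pairwise (\<lambda>u v. \<not> orthogonal_vec u v) I}"
  have "finite K" using K by (simp add: vector_set_def)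
  then have "finite F" by (simp add: F_def)
  moreover have "{} \<in> F" by (auto simp: F_def)
  ultimately obtain I where "I \<in> F" and max: "\<And>J. J \<in> F \<Longrightarrow> I \<subseteq> J \<Longrightarrow> I = J"
    using finite_has_maximal[of F] by blast
  then have I: "I \<subseteq> K" "pairwise (\<lambda>u v. \<not> orthogonal_vec u v) I" by (auto simp: F_def)
  have "\<exists>u\<in>I. orthogonal_vec u v" if v: "v \<in> K - I" for v
  proof (rule ccontr)
    assume no: "\<not> ?thesis"
    have "\<not> orthogonal_vec v u" if "u \<in> I" for u
      using no that v I K orthogonal_vec_sym[of v d u] by (auto simp: vector_set_def)
    then have "insert v I \<in> F"
      using no v I by (auto simp: F_def pairwise_insert)
    from max[OF this] show False using v by auto
  qed
  then show thesis using I that by blast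
qed

theorem theorem1:
  fixes d :: nat and K :: "complex vec set"
  assumes "d \<ge> 3" and "KS_set d K"
  shows "\<exists>k S. 2 \<le> k \<and> k \<le> d \<and> S \<subseteq> K \<and> gadget d k (k - 1) S"
proof -
  have K: "vector_set d K" using assms(2) by (simp add: KS_set_def)
  obtain I where I: "I \<subseteq> K" "pairwise (\<lambda>u v. \<not> orthogonal_vec u v) I"
    and max: "\<And>v. v \<in> K - I \<Longrightarrow> \<exists>u\<in>I. orthogonal_vec u v"
    using maximal_non_orthogonal_subset[OF K] by metis
  obtain B where B: "B \<subseteq> K" "card B = d" "pairwise orthogonal_vec B" "B \<inter> I = {}"
    using KS_set_basis_avoiding[OF assms(2) I] .
  have finB: "finite B" and "B \<noteq> {}"
    using B(2) assms(1) by (auto intro: card_ge_0_finite)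
  have "\<forall>b\<in>B. \<exists>t\<in>I. orthogonal_vec t b" using max B by blast
  then obtain g where g: "\<And>b. b \<in> B \<Longrightarrow> g b \<in> I" "\<And>b. b \<in> B \<Longrightarrow> orthogonal_vec (g b) b"
    by metis
  let ?cover = "\<lambda>T. \<forall>b\<in>B. \<exists>t\<in>T. orthogonal_vec t b"
  \<comment> \<open>Restricting to covers inside the image of \<open>B\<close> under
    \<open>g\<close> keeps them within \<open>I\<close> and gives
    \<open>card T \<le> card B = d\<close>.\<close>
  define F where "F = {T. T \<subseteq> g ` B \<and> ?cover T}"
  have "finite F" using finB by (simp add: F_def)
  moreover have "g ` B \<in> F" using g by (auto simp: F_def)
  ultimately obtain T where "T \<in> F" and min: "\<And>R. R \<in> F \<Longrightarrow> R \<subseteq> T \<Longrightarrow> R = T"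
    using finite_has_minimal[of F] by blast
  then have T: "T \<subseteq> g ` B" "?cover T" by (auto simp: F_def)
  have "T \<subseteq> I" using T g(1) by auto
  have S: "T \<union> B \<subseteq> K" using \<open>T \<subseteq> I\<close> I(1) B(1) by auto
  have "gadget d (card T) (card T - 1) (T \<union> B)"
  proof (rule gadget_of_minimal_cover)
    fix R assume "R \<subset> T"
    then have "\<not> ?cover R" using min[of R] T(1) by (auto simp: F_def)
    then show "\<exists>b\<in>B. \<forall>t\<in>R. \<not> orthogonal_vec t b" by blast
  qed (use \<open>T \<subseteq> I\<close> \<open>B \<noteq> {}\<close> B T vector_set_subset[OF K S] pairwise_subset[OF I(2)] in auto)
  moreover have "card T \<le> d"
    using T finB B(2) surj_card_le[of B T g] by auto
  moreover have "card T \<ge> 2"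
  proof -
    have "finite T" using T finB by (simp add: finite_subset)
    moreover have "T \<noteq> {}" using T \<open>B \<noteq> {}\<close> by auto
    \<comment> \<open>A one-element cover would be a unit vector orthogonal to a whole
      basis.\<close>
    moreover have "T \<noteq> {t}" for t
    proof
      assume "T = {t}"
      then have "\<forall>b\<in>B. orthogonal_vec t b" "t \<in> K" using T S by auto
      then show False using not_orthogonal_to_basis[OF K B(1,3,2)] by blast
    qed
    ultimately have "card T \<noteq> 0" "card T \<noteq> 1"
      by (simp_all add: card_1_singleton_iff)
    then show ?thesis by linarith
  qed
  ultimately show ?thesis using S by blast
qed

end
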